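(* For every $n\ge1$ and $c\in\mathbb Z$, $$f(n,c,x)=\sum_{i=1}^{n}x^{\Delta(n,c,i)}\,f\bigl(i-1,c-(n-i+1),x\bigr)\,f\bigl(n-i,c+i-1,x\bigr),$$ where $$\Delta(n,c,i)=\begin{cases}1,& i+c\in\{2,\ldots,n-i+1\},\\ 0,&\text{otherwise},\end{cases}$$ with initial condition $f(0,c,x)=1$. In particular, $f_{213}(n,x)=f(n,0,x)$.
   Context: $\mathfrak S_n$ is the set of permutations of $\{1,\dots,n\}$ and $\operatorname{Av}_n(213)$ is the set of $\pi\in\mathfrak S_n$ with no subsequence order-isomorphic to $213$. $\operatorname{DD}(\pi)$ is the number of indices $k$ with $\pi(k)<k<\pi^{-1}(k)$ (double deficiencies), and $f_{213}(n,x)=\sum_{\pi\in\operatorname{Av}_n(213)}x^{\operatorname{DD}(\pi)}$. For $\pi\in\mathfrak S_n$ and $c\in\mathbb Z$, the number of shifted double deficiencies of $\pi$ with shift $c$ is $$\operatorname{DD}_c(\pi)=\#\{j\in\{1,\ldots,n\}: 1\le j+c\le n,\ \pi(j)<j+c<\pi^{-1}(j+c)+c\}.$$ For $n\ge 0$ and $c\in\mathbb Z$, $f(n,c,x)=\sum_{\pi\in\operatorname{Av}_n(213)}x^{\operatorname{DD}_c(\pi)}$. The set $\{2,\ldots,n-i+1\}$ is empty when $n-i+1<2$. *)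

theory Defs
  imports "HOL-Library.Sublist" "HOL-Combinatorics.Permutations"
begin

definition order_isomorphic :: "nat list \<Rightarrow> nat list \<Rightarrow> bool" where
  "order_isomorphic xs ys \<longleftrightarrow> length xs = length ys \<and>
     (\<forall>a < length xs. \<forall>b < length xs. xs ! a < xs ! b \<longleftrightarrow> ys ! a < ys ! b)"

text \<open>A pattern is given by its one-line notation, e.g. 213 is the list \<open>[2, 1, 3]\<close>.\<close>

definition Av :: "nat list \<Rightarrow> nat \<Rightarrow> (nat \<Rightarrow> nat) set" where
  "Av p n = {\<pi>. \<pi> permutes {1..n} \<and>
     \<not> (\<exists>ys. subseq ys (map \<pi> [1..<Suc n]) \<and> order_isomorphic ys p)}"

definition DD :: "nat \<Rightarrow> (nat \<Rightarrow> nat) \<Rightarrow> nat" where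
  "DD n \<pi> = card {k \<in> {1..n}. \<pi> k < k \<and> k < inv \<pi> k}"

text \<open>The shift \<open>c\<close> may be negative, so the comparisons are made over the integers; the
  conversion by \<open>nat\<close> below only matters when \<open>1 \<le> int j + c\<close>.\<close>

definition shifted_DD :: "nat \<Rightarrow> int \<Rightarrow> (nat \<Rightarrow> nat) \<Rightarrow> nat" where
  "shifted_DD n c \<pi> = card {j \<in> {1..n}. 1 \<le> int j + c \<and> int j + c \<le> int n \<and>
     int (\<pi> j) < int j + c \<and> int j + c < int (inv \<pi> (nat (int j + c))) + c}"

text \<open>The variable \<open>x\<close> ranges over an arbitrary commutative semiring. Taking \<open>x\<close> to be
  the polynomial indeterminate gives the generating polynomials themselves.\<close>

definition f213 :: "nat \<Rightarrow> 'a::comm_semiring_1 \<Rightarrow> 'a" where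
  "f213 n x = (\<Sum>\<pi>\<in>Av [2, 1, 3] n. x ^ DD n \<pi>)"

definition f :: "nat \<Rightarrow> int \<Rightarrow> 'a::comm_semiring_1 \<Rightarrow> 'a" where
  "f n c x = (\<Sum>\<pi>\<in>Av [2, 1, 3] n. x ^ shifted_DD n c \<pi>)"

definition Delta :: "nat \<Rightarrow> int \<Rightarrow> nat \<Rightarrow> nat" where
  "Delta n c i = (if int i + c \<in> {2..int n - int i + 1} then 1 else 0)"

end

theory Submission imports Defs begin

text \<open>
  A permutation \<open>\<pi>\<close> of \<open>{1..n}\<close> with \<open>\<pi> i = 1\<close> avoids 213 only if every entry left of position
  \<open>i\<close> exceeds every entry right of it: entries \<open>\<pi> a < \<pi> c\<close> with \<open>a < i < c\<close> would complete
  \<open>\<pi> a, 1, \<pi> c\<close> to a 213. Counting then forces the first \<open>p = i - 1\<close> positions to carry exactly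
  the \<open>p\<close> largest values and the last \<open>q = n - i\<close> positions the values \<open>2, \<dots>, q + 1\<close>, so
  the permutation consists of a 213-avoider \<open>\<alpha>\<close> of size \<open>p\<close> raised by \<open>q + 1\<close>, the entry 1, and a
  213-avoider \<open>\<beta>\<close> of size \<open>q\<close> raised by 1. Conversely all such gluings avoid 213
  (\<open>bij_betw_glue\<close>).

  For the statistic, write the value \<open>j + c\<close> as \<open>\<pi> k\<close>. Then \<open>j\<close> is a shifted double deficiency
  exactly when such a \<open>k\<close> exists with \<open>j < k\<close> and \<open>\<pi> j < \<pi> k\<close>; that is, \<open>(j, k)\<close> is a
  noninversion with \<open>\<pi> k - j = c\<close>, and \<open>k\<close> is determined by \<open>j\<close>
  (\<open>shifted_DD_eq_card_noninversions\<close>). In a gluing no noninversion leads out of the first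
  block. Noninversions inside a block are those of \<open>\<alpha>\<close> or \<open>\<beta>\<close>, but the translations of
  positions and values turn the difference \<open>c\<close> into \<open>c - (q + 1)\<close> and \<open>c + p\<close>. The
  noninversions starting at the entry 1 end at any value in \<open>{2..q + 1}\<close>, so there is one with
  \<open>\<pi> k = i + c\<close> exactly when \<open>Delta\<close> is 1. Hence the statistic is additive
  (\<open>shifted_DD_glue\<close>), and sorting the avoiders by \<open>i\<close> gives the recurrence.
\<close>

section \<open>Avoiding 213 and shifted double deficiencies without inverses\<close>

text \<open>A subsequence of length 3 of the one-line notation is the image of a subsequence
  \<open>[a, b, c]\<close> of \<open>[1..<Suc n]\<close>, and these are exactly the increasing triples of positions.\<close>

lemma Av_213_iff:
  "\<pi> \<in> Av [2, 1, 3] n \<longleftrightarrow> \<pi> permutes {1..n} \<and>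
     (\<forall>a b c. 1 \<le> a \<longrightarrow> a < b \<longrightarrow> b < c \<longrightarrow> c \<le> n \<longrightarrow> \<not> (\<pi> b < \<pi> a \<and> \<pi> a < \<pi> c))"
proof -
  have "(\<exists>ys. subseq ys (map \<pi> [1..<Suc n]) \<and> order_isomorphic ys [2, 1, 3]) \<longleftrightarrow>
        (\<exists>a b c. 1 \<le> a \<and> a < b \<and> b < c \<and> c \<le> n \<and> \<pi> b < \<pi> a \<and> \<pi> a < \<pi> c)"
    (is "?L \<longleftrightarrow> ?R")
  proof
    assume ?L
    then obtain N where iso: "order_isomorphic (map \<pi> (nths [1..<Suc n] N)) [2, 1, 3]"
      by (auto simp: subseq_conv_nths nths_map simp del: upt_Suc)
    then have "length (nths [1..<Suc n] N) = Suc (Suc (Suc 0))"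
      by (simp add: order_isomorphic_def del: upt_Suc)
    then obtain a b c where abc: "nths [1..<Suc n] N = [a, b, c]"
      by (auto simp: length_Suc_conv simp del: upt_Suc)
    have "sorted [a, b, c]" "distinct [a, b, c]" "set [a, b, c] \<subseteq> {1..n}"
      using sorted_nths[of "[1..<Suc n]" N] distinct_nthsI[of "[1..<Suc n]" N]
        set_nths_subset[of "[1..<Suc n]" N]
      unfolding abc by (auto simp del: upt_Suc)
    moreover have "\<pi> b < \<pi> a" "\<pi> a < \<pi> c"
      using iso[unfolded abc order_isomorphic_def]
      by (auto simp: numeral_3_eq_3 All_less_Suc2)
    ultimately show ?R
      by (auto simp: less_le)
  next
    assume ?R
    then obtain a b c where abc: "1 \<le> a" "a < b" "b < c" "c \<le> n" "\<pi> b < \<pi> a" "\<pi> a < \<pi> c"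
      by blast
    have "subseq [a, b, c] [1..<Suc n]"
      using abc by (intro sorted_subset_imp_subseq) (auto simp del: upt_Suc)
    then have "subseq (map \<pi> [a, b, c]) (map \<pi> [1..<Suc n])"
      by (rule subseq_map)
    moreover have "order_isomorphic (map \<pi> [a, b, c]) [2, 1, 3]"
      using abc by (auto simp: order_isomorphic_def less_Suc_eq numeral_3_eq_3)
    ultimately show ?L by blast
  qed
  then show ?thesis
    unfolding Av_def by blast
qed

lemma Av_permutes: "\<pi> \<in> Av pat n \<Longrightarrow> \<pi> permutes {1..n}"
  by (simp add: Av_def)

lemma Av_213_avoids:
  "\<pi> \<in> Av [2, 1, 3] n \<Longrightarrow> 1 \<le> a \<Longrightarrow> a < b \<Longrightarrow> b < c \<Longrightarrow> c \<le> n \<Longrightarrow> \<not> (\<pi> b < \<pi> a \<and> \<pi> a < \<pi> c)"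
  unfolding Av_213_iff by blast

lemma finite_Av: "finite (Av p n)"
  by (rule finite_subset[OF _ finite_permutations[of "{1..n}"]]) (auto simp: Av_def)

text \<open>In this form \<open>c\<close> is only ever compared with a difference of a value and a position, which is
  what makes translating a block by a constant harmless.\<close>

definition noninversion_starts :: "nat \<Rightarrow> int \<Rightarrow> (nat \<Rightarrow> nat) \<Rightarrow> nat set" where
  "noninversion_starts n c \<pi> =
     {j \<in> {1..n}. \<exists>k \<in> {j<..n}. int (\<pi> k) = int j + c \<and> \<pi> j < \<pi> k}"

lemma finite_noninversion_starts: "finite (noninversion_starts n c \<pi>)"
  by (simp add: noninversion_starts_def)

lemma shifted_DD_eq_card_noninversions:
  assumes "\<pi> permutes {1..n}"
  shows "shifted_DD n c \<pi> = card (noninversion_starts n c \<pi>)"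
proof -
  have "(1 \<le> int j + c \<and> int j + c \<le> int n \<and> int (\<pi> j) < int j + c
          \<and> int j + c < int (inv \<pi> (nat (int j + c))) + c) \<longleftrightarrow>
        (\<exists>k \<in> {j<..n}. int (\<pi> k) = int j + c \<and> \<pi> j < \<pi> k)" (is "?L \<longleftrightarrow> ?R") for j
  proof
    assume L: ?L
    define k where "k = inv \<pi> (nat (int j + c))"
    have k: "\<pi> k = nat (int j + c)"
      unfolding k_def using permutes_inverses(1)[OF assms] .
    then have "k \<in> {1..n}"
      using L permutes_in_image[OF assms, of k] by auto
    with L k show ?R
      by (intro bexI[of _ k]) (auto simp: k_def)
  next
    assume ?R
    then obtain k where k: "k \<in> {j<..n}" "int (\<pi> k) = int j + c" "\<pi> j < \<pi> k"
      by blast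
    then have "\<pi> k \<in> {1..n}"
      using permutes_in_image[OF assms, of k] by auto
    moreover have "inv \<pi> (nat (int j + c)) = k"
      using k(2) permutes_inverses(2)[OF assms, of k] by (metis nat_int)
    ultimately show ?L
      using k by auto
  qed
  then show ?thesis
    unfolding shifted_DD_def noninversion_starts_def by presburger
qed

section \<open>Gluing two 213-avoiders around the entry 1\<close>

text \<open>In the language of permutation sums this is the skew sum \<open>\<alpha> \<ominus> (1 \<oplus> \<beta>)\<close>; the last
  branch keeps it the identity outside \<open>{1..p + 1 + q}\<close>, as \<open>permutes\<close> demands.\<close>

definition glue :: "nat \<Rightarrow> nat \<Rightarrow> (nat \<Rightarrow> nat) \<Rightarrow> (nat \<Rightarrow> nat) \<Rightarrow> nat \<Rightarrow> nat" where
  "glue p q \<alpha> \<beta> j =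
     (if j \<in> {1..p} then \<alpha> j + (q + 1)
      else if j = p + 1 then 1
      else if j \<in> {p + 2..p + 1 + q} then \<beta> (j - (p + 1)) + 1
      else j)"

definition upper_block :: "nat \<Rightarrow> nat \<Rightarrow> (nat \<Rightarrow> nat) \<Rightarrow> nat \<Rightarrow> nat" where
  "upper_block p q \<pi> j = (if j \<in> {1..p} then \<pi> j - (q + 1) else j)"

definition lower_block :: "nat \<Rightarrow> nat \<Rightarrow> (nat \<Rightarrow> nat) \<Rightarrow> nat \<Rightarrow> nat" where
  "lower_block p q \<pi> j = (if j \<in> {1..q} then \<pi> (p + 1 + j) - 1 else j)"

lemma glue_upper: "j \<in> {1..p} \<Longrightarrow> glue p q \<alpha> \<beta> j = \<alpha> j + (q + 1)"
  and glue_one: "glue p q \<alpha> \<beta> (Suc p) = 1"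
  and glue_lower: "l \<in> {1..q} \<Longrightarrow> glue p q \<alpha> \<beta> (Suc (p + l)) = \<beta> l + 1"
  and glue_outside: "j \<notin> {1..p + 1 + q} \<Longrightarrow> glue p q \<alpha> \<beta> j = j"
  by (auto simp: glue_def)

lemmas glue_simps = glue_upper glue_one glue_lower

lemma glue_position_cases:
  fixes j p q :: nat
  assumes "j \<in> {1..p + 1 + q}"
  obtains (upper) "j \<in> {1..p}"
    | (one) "j = Suc p"
    | (lower) l where "l \<in> {1..q}" "j = Suc (p + l)"
proof -
  consider "j \<le> p" | "j = Suc p" | "Suc p < j" by linarith
  then show thesis
  proof cases
    case 3
    then show thesis
      using assms by (intro lower[of "j - Suc p"]) auto
  qed (use assms upper one in auto)
qed

lemma permutes_interval_bounds:
  fixes \<pi> :: "nat \<Rightarrow> nat"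
  assumes "\<pi> permutes {1..n}" "j \<in> {1..n}"
  shows "1 \<le> \<pi> j" "\<pi> j \<le> n"
  using permutes_in_image[OF assms(1), of j] assms(2) by auto

lemma glue_upper_value: "\<alpha> permutes {1..p} \<Longrightarrow> j \<in> {1..p} \<Longrightarrow> glue p q \<alpha> \<beta> j \<in> {q + 2..p + 1 + q}"
  using permutes_interval_bounds[of \<alpha> p j] by (simp add: glue_upper)

lemma glue_lower_value: "\<beta> permutes {1..q} \<Longrightarrow> l \<in> {1..q} \<Longrightarrow> glue p q \<alpha> \<beta> (Suc (p + l)) \<in> {2..q + 1}"
  using permutes_interval_bounds[of \<beta> q l] by (simp add: glue_lower)

lemma glue_permutes:
  assumes \<alpha>: "\<alpha> permutes {1..p}" and \<beta>: "\<beta> permutes {1..q}"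
  shows "glue p q \<alpha> \<beta> permutes {1..p + 1 + q}"
proof (rule inj_imp_permutes)
  note U = glue_upper_value[OF \<alpha>, of _ q \<beta>]
  note L = glue_lower_value[OF \<beta>, of _ p \<alpha>]
  show "glue p q \<alpha> \<beta> j \<in> {1..p + 1 + q}" if "j \<in> {1..p + 1 + q}" for j
    using that
  proof (cases rule: glue_position_cases)
    case upper
    then show ?thesis using U[OF upper] by simp
  next
    case one
    then show ?thesis by (simp add: glue_one)
  next
    case (lower l)
    then show ?thesis using L[OF lower(1)] by simp
  qed
  \<comment> \<open>Values of different parts lie in disjoint ranges: above \<open>q + 1\<close>, equal to 1, in \<open>{2..q + 1}\<close>.\<close>
  have neq: "glue p q \<alpha> \<beta> j \<noteq> glue p q \<alpha> \<beta> k"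
    if "j < k" "j \<in> {1..p + 1 + q}" "k \<in> {1..p + 1 + q}" for j k
    using that(2)
  proof (cases rule: glue_position_cases)
    case j: upper
    from that(3) show ?thesis
    proof (cases rule: glue_position_cases)
      case upper
      have "\<alpha> j \<noteq> \<alpha> k"
        using that(1) permutes_inj[OF \<alpha>, THEN injD, of j k] by auto
      then show ?thesis by (simp add: glue_upper[OF j] glue_upper[OF upper])
    next
      case one
      then show ?thesis using U[OF j] by (simp add: glue_one)
    next
      case (lower m)
      then show ?thesis using U[OF j] L[OF lower(1)] by simp
    qed
  next
    case j: one
    from that(3) show ?thesis
    proof (cases rule: glue_position_cases)
      case (lower m)
      then show ?thesis using L[OF lower(1)] j by (simp add: glue_one)
    qed (use that(1) j in auto)
  next
    case j: (lower l)
    from that(3) show ?thesis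
    proof (cases rule: glue_position_cases)
      case (lower m)
      have "\<beta> l \<noteq> \<beta> m"
        using that(1) j lower permutes_inj[OF \<beta>, THEN injD, of l m] by auto
      then show ?thesis
        by (simp add: j lower glue_lower[OF j(1)] glue_lower[OF lower(1)])
    qed (use that(1) j in auto)
  qed
  then show "inj_on (glue p q \<alpha> \<beta>) {1..p + 1 + q}"
    by (intro linorder_inj_onI') blast
qed (auto simp: glue_outside)

text \<open>The absence of noninversions leaving the first block is what both the avoidance of 213 and
  the additivity of the statistic rest on.\<close>

lemma glue_noninversion_cases:
  assumes \<alpha>: "\<alpha> permutes {1..p}" and \<beta>: "\<beta> permutes {1..q}"
    and "1 \<le> j" "j < k" "k \<le> p + 1 + q" "glue p q \<alpha> \<beta> j < glue p q \<alpha> \<beta> k"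
  obtains (upper) "j \<in> {1..p}" "k \<in> {1..p}" "\<alpha> j < \<alpha> k"
    | (one) m where "j = Suc p" "m \<in> {1..q}" "k = Suc (p + m)"
    | (lower) l m where "l \<in> {1..q}" "m \<in> {1..q}" "j = Suc (p + l)" "k = Suc (p + m)" "\<beta> l < \<beta> m"
proof -
  have j: "j \<in> {1..p + 1 + q}" and k: "k \<in> {1..p + 1 + q}"
    using assms by auto
  from j show thesis
  proof (cases rule: glue_position_cases)
    case j: upper
    from k show thesis
    proof (cases rule: glue_position_cases)
      case k: upper
      with j assms(6) show thesis
        by (intro upper) (simp_all only: glue_upper)
    next
      case one
      then show thesis
        using assms(6) glue_upper_value[OF \<alpha> j, of q \<beta>] by (simp add: glue_one)
    next
      case (lower m)
      then show thesis
        using assms(6) glue_upper_value[OF \<alpha> j, of q \<beta>] glue_lower_value[OF \<beta> lower(1), of p \<alpha>]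
        by simp
    qed
  next
    case j: one
    from k show thesis
    proof (cases rule: glue_position_cases)
      case (lower m)
      with j show thesis by (rule one)
    qed (use assms(4) j in auto)
  next
    case j: (lower l)
    from k show thesis
    proof (cases rule: glue_position_cases)
      case k: (lower m)
      with j assms(6) show thesis
        by (intro lower[of l m]) (simp_all add: glue_lower)
    qed (use assms(4) j in auto)
  qed
qed

lemma glue_in_Av:
  assumes "\<alpha> \<in> Av [2, 1, 3] p" "\<beta> \<in> Av [2, 1, 3] q"
  shows "glue p q \<alpha> \<beta> \<in> Av [2, 1, 3] (p + 1 + q)"
proof -
  have \<alpha>: "\<alpha> permutes {1..p}" and \<beta>: "\<beta> permutes {1..q}"
    using assms by (auto dest: Av_permutes)
  have "\<not> (glue p q \<alpha> \<beta> b < glue p q \<alpha> \<beta> a \<and> glue p q \<alpha> \<beta> a < glue p q \<alpha> \<beta> c)"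
    if abc: "1 \<le> a" "a < b" "b < c" "c \<le> p + 1 + q" for a b c
  proof
    assume less: "glue p q \<alpha> \<beta> b < glue p q \<alpha> \<beta> a \<and> glue p q \<alpha> \<beta> a < glue p q \<alpha> \<beta> c"
    have b: "b \<in> {1..p + 1 + q}" and ac: "a < c"
      using abc by auto
    from \<alpha> \<beta> \<open>1 \<le> a\<close> ac \<open>c \<le> p + 1 + q\<close> less[THEN conjunct2] show False
    proof (cases rule: glue_noninversion_cases)
      case upper
      then have "b \<in> {1..p}" using abc by auto
      with upper less have "\<alpha> b < \<alpha> a" by (simp add: glue_upper)
      with upper abc Av_213_avoids[OF assms(1), of a b c] show False by simp
    next
      case one
      then show False
        using less b permutes_interval_bounds(1)[OF glue_permutes[OF \<alpha> \<beta>], of b]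
        by (simp add: glue_one)
    next
      case (lower l m)
      define b' where "b' = b - Suc p"
      have b': "b = Suc (p + b')" "l < b'" "b' < m" "b' \<in> {1..q}"
        using abc lower by (auto simp: b'_def)
      with lower less have "\<beta> b' < \<beta> l" by (simp add: glue_lower)
      with lower b' Av_213_avoids[OF assms(2), of l b' m] show False by simp
    qed
  qed
  then show ?thesis
    using glue_permutes[OF \<alpha> \<beta>] by (intro iffD2[OF Av_213_iff] conjI allI impI)
qed

section \<open>Every 213-avoider is a gluing\<close>

text \<open>Avoidance makes every value left of the entry 1 larger than every value right of it, so the
  two sets of values can be told apart by counting how many lie above or below a given one.\<close>

lemma Av_213_block_values:
  assumes \<pi>: "\<pi> \<in> Av [2, 1, 3] (p + 1 + q)" and one: "\<pi> (Suc p) = 1"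
  shows "j \<in> {1..p} \<Longrightarrow> \<pi> j \<in> {q + 2..p + 1 + q}"
    and "j \<in> {p + 2..p + 1 + q} \<Longrightarrow> \<pi> j \<in> {2..q + 1}"
proof -
  have perm: "\<pi> permutes {1..p + 1 + q}"
    using \<pi> by (rule Av_permutes)
  note bounds = permutes_interval_bounds[OF perm]
  have card_image: "card (\<pi> ` S) = card S" for S
    by (rule card_image[OF permutes_inj_on[OF perm]])
  have "\<pi> j \<noteq> 1" if "j \<noteq> Suc p" for j
    using one that permutes_inj[OF perm, THEN injD, of j "Suc p"] by auto
  then have gt1: "1 < \<pi> j" if "j \<in> {1..p + 1 + q}" "j \<noteq> Suc p" for j
    using bounds(1)[OF that(1)] that(2) by (metis le_neq_implies_less)
  have sep: "\<pi> k < \<pi> j" if j: "j \<in> {1..p}" and k: "k \<in> {Suc p..p + 1 + q}" for j k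
  proof (cases "k = Suc p")
    case True
    then show ?thesis using gt1[of j] j one by auto
  next
    case False
    then have "1 \<le> j" "j < Suc p" "Suc p < k" "k \<le> p + 1 + q"
      using j k by auto
    then have "\<not> (\<pi> (Suc p) < \<pi> j \<and> \<pi> j < \<pi> k)"
      by (rule Av_213_avoids[OF \<pi>])
    moreover have "\<pi> (Suc p) < \<pi> j"
      using gt1[of j] j one by auto
    moreover have "\<pi> j \<noteq> \<pi> k"
      using permutes_inj[OF perm, THEN injD, of j k] j k by auto
    ultimately show ?thesis by linarith
  qed
  show "\<pi> j \<in> {q + 2..p + 1 + q}" if j: "j \<in> {1..p}"
  proof -
    \<comment> \<open>All \<open>q + 1\<close> values from position \<open>Suc p\<close> on fit below \<open>\<pi> j\<close>.\<close>
    have "\<pi> ` {Suc p..p + 1 + q} \<subseteq> {1..<\<pi> j}"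
      using sep[OF j] bounds(1) by auto
    from card_mono[OF _ this] have "q + 1 \<le> \<pi> j - 1"
      by (simp add: card_image)
    then show ?thesis using bounds(2)[of j] j by auto
  qed
  show "\<pi> j \<in> {2..q + 1}" if j: "j \<in> {p + 2..p + 1 + q}"
  proof -
    \<comment> \<open>All \<open>p\<close> values before position \<open>Suc p\<close> fit above \<open>\<pi> j\<close>.\<close>
    have "\<pi> ` {1..p} \<subseteq> {\<pi> j<..p + 1 + q}"
      using sep[of _ j] j bounds(2) by auto
    from card_mono[OF _ this] have "p \<le> p + 1 + q - \<pi> j"
      by (simp add: card_image)
    then show ?thesis using bounds(2)[of j] gt1[of j] j by auto
  qed
qed

lemma upper_block_in_Av:
  assumes \<pi>: "\<pi> \<in> Av [2, 1, 3] (p + 1 + q)" and one: "\<pi> (Suc p) = 1"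
  shows "upper_block p q \<pi> \<in> Av [2, 1, 3] p"
proof -
  have inj: "\<pi> j = \<pi> k \<Longrightarrow> j = k" for j k
    using permutes_inj[OF Av_permutes[OF \<pi>], THEN injD] .
  note vals = Av_213_block_values(1)[OF \<pi> one]
  have shift: "upper_block p q \<pi> j + (q + 1) = \<pi> j" if "j \<in> {1..p}" for j
    using vals[OF that] that by (auto simp: upper_block_def)
  have "upper_block p q \<pi> permutes {1..p}"
  proof (rule inj_imp_permutes)
    show "inj_on (upper_block p q \<pi>) {1..p}"
      by (rule inj_onI, rule inj) (metis shift)
    show "upper_block p q \<pi> j \<in> {1..p}" if "j \<in> {1..p}" for j
      using vals[OF that] shift[OF that] by auto
  qed (auto simp: upper_block_def)
  moreover have "\<not> (upper_block p q \<pi> b < upper_block p q \<pi> a \<and>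
      upper_block p q \<pi> a < upper_block p q \<pi> c)"
    if "1 \<le> a" "a < b" "b < c" "c \<le> p" for a b c
  proof -
    have "\<not> (\<pi> b < \<pi> a \<and> \<pi> a < \<pi> c)"
      using that by (intro Av_213_avoids[OF \<pi>]) auto
    then show ?thesis
      using shift[of a] shift[of b] shift[of c] that by auto
  qed
  ultimately show ?thesis
    by (intro iffD2[OF Av_213_iff] conjI allI impI)
qed

lemma lower_block_in_Av:
  assumes \<pi>: "\<pi> \<in> Av [2, 1, 3] (p + 1 + q)" and one: "\<pi> (Suc p) = 1"
  shows "lower_block p q \<pi> \<in> Av [2, 1, 3] q"
proof -
  have inj: "\<pi> j = \<pi> k \<Longrightarrow> j = k" for j k
    using permutes_inj[OF Av_permutes[OF \<pi>], THEN injD] .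
  have vals: "\<pi> (p + 1 + l) \<in> {2..q + 1}" if "l \<in> {1..q}" for l
    using Av_213_block_values(2)[OF \<pi> one, of "p + 1 + l"] that by auto
  have shift: "lower_block p q \<pi> l + 1 = \<pi> (p + 1 + l)" if "l \<in> {1..q}" for l
    using vals[OF that] that by (auto simp: lower_block_def)
  have "lower_block p q \<pi> permutes {1..q}"
  proof (rule inj_imp_permutes)
    show "inj_on (lower_block p q \<pi>) {1..q}"
      by (rule inj_onI) (metis shift inj add_left_cancel)
    show "lower_block p q \<pi> l \<in> {1..q}" if "l \<in> {1..q}" for l
      using vals[OF that] shift[OF that] by auto
  qed (auto simp: lower_block_def)
  moreover have "\<not> (lower_block p q \<pi> b < lower_block p q \<pi> a \<and>
      lower_block p q \<pi> a < lower_block p q \<pi> c)"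
    if "1 \<le> a" "a < b" "b < c" "c \<le> q" for a b c
  proof -
    have "1 \<le> p + 1 + a" "p + 1 + a < p + 1 + b" "p + 1 + b < p + 1 + c" "p + 1 + c \<le> p + 1 + q"
      using that by auto
    then have "\<not> (\<pi> (p + 1 + b) < \<pi> (p + 1 + a) \<and> \<pi> (p + 1 + a) < \<pi> (p + 1 + c))"
      by (rule Av_213_avoids[OF \<pi>])
    then show ?thesis
      using shift[of a] shift[of b] shift[of c] that by auto
  qed
  ultimately show ?thesis
    by (intro iffD2[OF Av_213_iff] conjI allI impI)
qed

lemma glue_blocks:
  assumes \<pi>: "\<pi> \<in> Av [2, 1, 3] (p + 1 + q)" and one: "\<pi> (Suc p) = 1"
  shows "glue p q (upper_block p q \<pi>) (lower_block p q \<pi>) = \<pi>"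
proof
  fix j
  show "glue p q (upper_block p q \<pi>) (lower_block p q \<pi>) j = \<pi> j"
  proof (cases "j \<in> {1..p + 1 + q}")
    case True
    then show ?thesis
      using Av_213_block_values[OF \<pi> one, of j] one
      by (elim glue_position_cases) (auto simp: glue_simps upper_block_def lower_block_def)
  next
    case False
    then show ?thesis
      using permutes_not_in[OF Av_permutes[OF \<pi>] False] by (simp add: glue_outside)
  qed
qed

lemma upper_block_glue:
  assumes "\<alpha> permutes {1..p}"
  shows "upper_block p q (glue p q \<alpha> \<beta>) = \<alpha>"
  using assms by (auto simp: fun_eq_iff upper_block_def glue_upper permutes_not_in)

lemma lower_block_glue:
  assumes "\<beta> permutes {1..q}"
  shows "lower_block p q (glue p q \<alpha> \<beta>) = \<beta>"
  using assms by (auto simp: fun_eq_iff lower_block_def glue_lower permutes_not_in)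

text \<open>The fibre of the recurrence at \<open>i = Suc p\<close>: the two blocks can be read off a gluing and vary
  independently.\<close>

lemma bij_betw_glue:
  "bij_betw (\<lambda>(\<alpha>, \<beta>). glue p q \<alpha> \<beta>) (Av [2, 1, 3] p \<times> Av [2, 1, 3] q)
     {\<pi> \<in> Av [2, 1, 3] (p + 1 + q). \<pi> (Suc p) = 1}"
proof (rule bij_betw_byWitness[where f' = "\<lambda>\<pi>. (upper_block p q \<pi>, lower_block p q \<pi>)"])
  show "\<forall>a \<in> Av [2, 1, 3] p \<times> Av [2, 1, 3] q.
      (\<lambda>\<pi>. (upper_block p q \<pi>, lower_block p q \<pi>)) ((\<lambda>(\<alpha>, \<beta>). glue p q \<alpha> \<beta>) a) = a"
    using upper_block_glue[OF Av_permutes] lower_block_glue[OF Av_permutes] by auto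
  show "\<forall>\<pi> \<in> {\<pi> \<in> Av [2, 1, 3] (p + 1 + q). \<pi> (Suc p) = 1}.
      (\<lambda>(\<alpha>, \<beta>). glue p q \<alpha> \<beta>) (upper_block p q \<pi>, lower_block p q \<pi>) = \<pi>"
    using glue_blocks by simp
  show "(\<lambda>(\<alpha>, \<beta>). glue p q \<alpha> \<beta>) ` (Av [2, 1, 3] p \<times> Av [2, 1, 3] q)
      \<subseteq> {\<pi> \<in> Av [2, 1, 3] (p + 1 + q). \<pi> (Suc p) = 1}"
    using glue_in_Av[of _ p _ q] by (auto simp: glue_one)
  show "(\<lambda>\<pi>. (upper_block p q \<pi>, lower_block p q \<pi>)) `
      {\<pi> \<in> Av [2, 1, 3] (p + 1 + q). \<pi> (Suc p) = 1} \<subseteq> Av [2, 1, 3] p \<times> Av [2, 1, 3] q"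
    using upper_block_in_Av[of _ p q] lower_block_in_Av[of _ p q] by auto
qed

section \<open>Additivity of the statistic\<close>

text \<open>At the entry 1 the partner \<open>k\<close> must carry the value \<open>p + 1 + c\<close>; the second block contains
  it exactly when this number lies in \<open>{2..q + 1}\<close>, the condition in \<open>Delta\<close>.\<close>

lemma noninversion_starts_glue:
  assumes \<alpha>: "\<alpha> permutes {1..p}" and \<beta>: "\<beta> permutes {1..q}"
  shows "noninversion_starts (p + 1 + q) c (glue p q \<alpha> \<beta>) =
     noninversion_starts p (c - (int q + 1)) \<alpha> \<union>
     (if int (Suc p) + c \<in> {2..int q + 1} then {Suc p} else {}) \<union>
     (\<lambda>l. Suc (p + l)) ` noninversion_starts q (c + int p) \<beta>" (is "?L = ?A \<union> ?O \<union> ?B")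
proof (intro equalityI subsetI)
  fix j
  assume "j \<in> ?L"
  then obtain k where "1 \<le> j" "j < k" "k \<le> p + 1 + q"
    and val: "int (glue p q \<alpha> \<beta> k) = int j + c" and "glue p q \<alpha> \<beta> j < glue p q \<alpha> \<beta> k"
    by (auto simp: noninversion_starts_def)
  note jk = this
  from \<alpha> \<beta> jk(1,2,3,5) show "j \<in> ?A \<union> ?O \<union> ?B"
  proof (cases rule: glue_noninversion_cases)
    case upper
    then have "j \<in> ?A"
      using jk by (auto simp: noninversion_starts_def glue_upper intro!: bexI[of _ k])
    then show ?thesis by blast
  next
    case (one m)
    then show ?thesis
      using val permutes_interval_bounds[OF \<beta>, of m] by (auto simp: glue_lower)
  next
    case (lower l m)
    then have "l \<in> noninversion_starts q (c + int p) \<beta>"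
      using jk by (auto simp: noninversion_starts_def glue_lower intro!: bexI[of _ m])
    then show ?thesis using lower by blast
  qed
next
  fix j
  assume "j \<in> ?A \<union> ?O \<union> ?B"
  then consider "j \<in> ?A" | "j \<in> ?O" | "j \<in> ?B" by blast
  then show "j \<in> ?L"
  proof cases
    case 1
    then obtain k where "j \<in> {1..p}" "k \<in> {j<..p}" "int (\<alpha> k) = int j + (c - (int q + 1))" "\<alpha> j < \<alpha> k"
      by (auto simp: noninversion_starts_def)
    then show ?thesis
      by (auto simp: noninversion_starts_def glue_upper intro!: bexI[of _ k])
  next
    case 2
    then have j: "j = Suc p" and range: "int (Suc p) + c \<in> {2..int q + 1}"
      by (auto split: if_splits)
    define m where "m = inv \<beta> (nat (int p + c))"
    have \<beta>m: "\<beta> m = nat (int p + c)"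
      unfolding m_def by (rule permutes_inverses(1)[OF \<beta>])
    have "m \<in> {1..q}"
      using permutes_in_image[OF \<beta>, of m] range unfolding \<beta>m by auto
    then show ?thesis
      using j range \<beta>m
      by (auto simp: noninversion_starts_def glue_one glue_lower intro!: bexI[of _ "Suc (p + m)"])
  next
    case 3
    then obtain l m where "j = Suc (p + l)" "l \<in> {1..q}" "m \<in> {l<..q}"
      "int (\<beta> m) = int l + (c + int p)" "\<beta> l < \<beta> m"
      by (auto simp: noninversion_starts_def)
    then show ?thesis
      by (auto simp: noninversion_starts_def glue_lower intro!: bexI[of _ "Suc (p + m)"])
  qed
qed

lemma shifted_DD_glue:
  assumes \<alpha>: "\<alpha> permutes {1..p}" and \<beta>: "\<beta> permutes {1..q}"
  shows "shifted_DD (p + 1 + q) c (glue p q \<alpha> \<beta>) =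
     Delta (p + 1 + q) c (Suc p) +
     shifted_DD p (c - (int q + 1)) \<alpha> + shifted_DD q (c + int p) \<beta>"
proof -
  let ?A = "noninversion_starts p (c - (int q + 1)) \<alpha>"
  let ?O = "if int (Suc p) + c \<in> {2..int q + 1} then {Suc p} else {}"
  let ?B = "(\<lambda>l. Suc (p + l)) ` noninversion_starts q (c + int p) \<beta>"
  have "?A \<inter> ?O = {}" "(?A \<union> ?O) \<inter> ?B = {}"
    by (auto simp: noninversion_starts_def)
  then have "card (?A \<union> ?O \<union> ?B) = card ?A + card ?O + card ?B"
    by (simp add: card_Un_disjoint finite_noninversion_starts)
  moreover have "card ?B = card (noninversion_starts q (c + int p) \<beta>)"
    by (rule card_image) (simp add: inj_on_def)
  moreover have "card ?O = Delta (p + 1 + q) c (Suc p)"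
    by (simp add: Delta_def)
  ultimately show ?thesis
    by (simp only: noninversion_starts_glue[OF \<alpha> \<beta>] shifted_DD_eq_card_noninversions \<alpha> \<beta>
        glue_permutes[OF \<alpha> \<beta>])
qed

section \<open>The recurrence\<close>

lemma sum_Av_with_one_at:
  fixes x :: "'a::comm_semiring_1"
  shows "(\<Sum>\<pi> | \<pi> \<in> Av [2, 1, 3] (p + 1 + q) \<and> \<pi> (Suc p) = 1. x ^ shifted_DD (p + 1 + q) c \<pi>) =
     x ^ Delta (p + 1 + q) c (Suc p) * f p (c - (int q + 1)) x * f q (c + int p) x" (is "?S = _")
proof -
  have "?S = (\<Sum>(\<alpha>, \<beta>) \<in> Av [2, 1, 3] p \<times> Av [2, 1, 3] q.
      x ^ shifted_DD (p + 1 + q) c (glue p q \<alpha> \<beta>))"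
    by (subst sum.reindex_bij_betw[OF bij_betw_glue, symmetric]) (simp add: case_prod_unfold)
  also have "\<dots> = (\<Sum>(\<alpha>, \<beta>) \<in> Av [2, 1, 3] p \<times> Av [2, 1, 3] q. x ^ Delta (p + 1 + q) c (Suc p) *
      (x ^ shifted_DD p (c - (int q + 1)) \<alpha> * x ^ shifted_DD q (c + int p) \<beta>))"
  proof (rule sum.cong[OF refl], clarify)
    fix \<alpha> \<beta>
    assume "\<alpha> \<in> Av [2, 1, 3] p" "\<beta> \<in> Av [2, 1, 3] q"
    then have "\<alpha> permutes {1..p}" "\<beta> permutes {1..q}"
      by (auto dest: Av_permutes)
    from shifted_DD_glue[OF this, of c]
    show "x ^ shifted_DD (p + 1 + q) c (glue p q \<alpha> \<beta>) = x ^ Delta (p + 1 + q) c (Suc p) *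
        (x ^ shifted_DD p (c - (int q + 1)) \<alpha> * x ^ shifted_DD q (c + int p) \<beta>)"
      by (simp only: power_add mult.assoc)
  qed
  also have "\<dots> = x ^ Delta (p + 1 + q) c (Suc p) * (f p (c - (int q + 1)) x * f q (c + int p) x)"
    unfolding f_def sum_product sum.cartesian_product by (simp add: sum_distrib_left case_prod_unfold)
  finally show ?thesis
    by (simp only: mult.assoc)
qed

lemma f_recurrence:
  fixes x :: "'a::comm_semiring_1"
  assumes "n \<ge> 1"
  shows "f n c x = (\<Sum>i=1..n. x ^ Delta n c i * f (i - 1) (c - (int n - int i + 1)) x
                                   * f (n - i) (c + int i - 1) x)"
proof -
  have position: "inv \<pi> 1 = i \<longleftrightarrow> \<pi> i = 1" "inv \<pi> 1 \<in> {1..n}" if "\<pi> \<in> Av [2, 1, 3] n" for \<pi> i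
    using permutes_inv_eq[OF Av_permutes[OF that], of 1 i]
      permutes_in_image[OF permutes_inv[OF Av_permutes[OF that]], of 1] assms
    by auto
  have "f n c x = (\<Sum>i=1..n. \<Sum>\<pi> | \<pi> \<in> Av [2, 1, 3] n \<and> inv \<pi> 1 = i. x ^ shifted_DD n c \<pi>)"
    unfolding f_def using position(2) by (intro sum.group[symmetric]) (auto simp: finite_Av)
  also have "\<dots> = (\<Sum>i=1..n. x ^ Delta n c i * f (i - 1) (c - (int n - int i + 1)) x
                                   * f (n - i) (c + int i - 1) x)"
  proof (rule sum.cong[OF refl])
    fix i
    assume i: "i \<in> {1..n}"
    define p q where "p = i - 1" and "q = n - i"
    have n: "n = p + 1 + q" and i: "i = Suc p"
      using i by (auto simp: p_def q_def)
    have "{\<pi>. \<pi> \<in> Av [2, 1, 3] n \<and> inv \<pi> 1 = i} = {\<pi>. \<pi> \<in> Av [2, 1, 3] n \<and> \<pi> i = 1}"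
      using position(1) by blast
    moreover have "c - (int n - int i + 1) = c - (int q + 1)" "c + int i - 1 = c + int p"
      "i - 1 = p" "n - i = q"
      by (simp_all add: n i)
    ultimately show "(\<Sum>\<pi> | \<pi> \<in> Av [2, 1, 3] n \<and> inv \<pi> 1 = i. x ^ shifted_DD n c \<pi>) =
        x ^ Delta n c i * f (i - 1) (c - (int n - int i + 1)) x * f (n - i) (c + int i - 1) x"
      using sum_Av_with_one_at[where x = x and c = c and p = p and q = q]
      by (simp only: n[symmetric] i[symmetric])
  qed
  finally show ?thesis .
qed

lemma f_0: "f 0 c x = 1"
proof -
  have "Av [2, 1, 3] 0 = {id}"
    unfolding set_eq_iff Av_213_iff by auto
  then show ?thesis
    by (simp add: f_def shifted_DD_def)
qed

lemma DD_eq_shifted_DD_0: "DD n \<pi> = shifted_DD n 0 \<pi>"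
  unfolding DD_def shifted_DD_def by (rule arg_cong[where f = card]) auto

theorem proposition6:
  fixes x :: "'a::comm_semiring_1"
  shows "(\<forall>n\<ge>1. \<forall>c. f n c x =
           (\<Sum>i=1..n. x ^ Delta n c i * f (i - 1) (c - (int n - int i + 1)) x
                                   * f (n - i) (c + int i - 1) x))
       \<and> (\<forall>c. f 0 c x = 1)
       \<and> (\<forall>n. f213 n x = f n 0 x)"
  using f_recurrence f_0 by (auto simp: f213_def f_def[of _ 0] DD_eq_shifted_DD_0)

end
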